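(* Let $\mathcal{H}$ and $Y$ be complex Hilbert spaces and let $X:D(X)\to Y$ be an unbounded linear operator whose domain $D(X)$ is a proper linear subspace of $\mathcal{H}$. Then there exists a unitary operator $U:\mathcal{H}\to\mathcal{H}$ such that $U(D(X))\not\subseteq D(X)$.
   Context: A linear operator $X:D(X)\to Y$ is unbounded if there is no constant $C$ with $\|Xv\|_Y\le C\|v\|_{\mathcal{H}}$ for all $v\in D(X)$. *)

theory Defs
  imports Complex_Main
begin

class scaleC =
  fixes scaleC :: "complex \<Rightarrow> 'a \<Rightarrow> 'a"  (infixr \<open>*\<^sub>C\<close> 75)

class complex_vector = real_vector + scaleC +
  assumes scaleC_add_right: "c *\<^sub>C (x + y) = c *\<^sub>C x + c *\<^sub>C y"
    and scaleC_add_left: "(c + d) *\<^sub>C x = c *\<^sub>C x + d *\<^sub>C x"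
    and scaleC_scaleC: "c *\<^sub>C d *\<^sub>C x = (c * d) *\<^sub>C x"
    and scaleC_one: "1 *\<^sub>C x = x"
    and scaleR_scaleC: "r *\<^sub>R x = complex_of_real r *\<^sub>C x"

interpretation complex_vector:
  vector_space "scaleC :: complex \<Rightarrow> 'a \<Rightarrow> 'a::complex_vector"
  by unfold_locales
    (simp_all add: scaleC_add_right scaleC_add_left scaleC_scaleC scaleC_one)

text \<open>
  The inner product is linear in its first argument. Building on
  \<^class>\<open>real_normed_vector\<close> supplies the topology and
  costs no generality: the norm is forced to be the one induced by the inner product,
  and that is always a norm.
\<close>

class complex_inner = complex_vector + real_normed_vector +
  fixes cinner :: "'a \<Rightarrow> 'a \<Rightarrow> complex"
  assumes cinner_add_left: "cinner (x + y) z = cinner x z + cinner y z"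
    and cinner_scaleC_left: "cinner (c *\<^sub>C x) y = c * cinner x y"
    and cinner_commute: "cinner x y = cnj (cinner y x)"
    and cinner_ge_zero: "0 \<le> Re (cinner x x)"
    and cinner_eq_zero_iff: "cinner x x = 0 \<longleftrightarrow> x = 0"
    and norm_eq_sqrt_cinner: "norm x = sqrt (Re (cinner x x))"

class chilbert_space = complex_inner + banach

instantiation complex :: chilbert_space
begin

definition scaleC_complex :: "complex \<Rightarrow> complex \<Rightarrow> complex"
  where "scaleC_complex c x = c * x"

definition cinner_complex :: "complex \<Rightarrow> complex \<Rightarrow> complex"
  where "cinner_complex x y = x * cnj y"

instance
  by standard
    (simp_all add: scaleC_complex_def cinner_complex_def algebra_simps scaleR_conv_of_real
      cmod_def power2_eq_square)

end

text \<open>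
  An operator with domain \<^term>\<open>D\<close> is a total function of which only the values on
  \<^term>\<open>D\<close> matter.
\<close>

definition clinear_on ::
    "'a::complex_vector set \<Rightarrow> ('a \<Rightarrow> 'b::complex_vector) \<Rightarrow> bool"
  where "clinear_on D X \<longleftrightarrow>
    (\<forall>x\<in>D. \<forall>y\<in>D. X (x + y) = X x + X y) \<and>
    (\<forall>c. \<forall>x\<in>D. X (c *\<^sub>C x) = c *\<^sub>C X x)"

definition unbounded_on ::
    "'a::real_normed_vector set \<Rightarrow> ('a \<Rightarrow> 'b::real_normed_vector) \<Rightarrow> bool"
  where "unbounded_on D X \<longleftrightarrow> \<not> (\<exists>C::real. \<forall>v\<in>D. norm (X v) \<le> C * norm v)"

definition unitary :: "('a::complex_inner \<Rightarrow> 'a) \<Rightarrow> bool"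
  where "unitary U \<longleftrightarrow> Vector_Spaces.linear scaleC scaleC U \<and> surj U \<and>
    (\<forall>x y. cinner (U x) (U y) = cinner x y)"

end

(* If w lies outside D and v in D is not orthogonal to w, the reflection along w sends v to v - c w
   with c nonzero, hence out of D. Orthogonality is repaired by replacing w with w + v, which is
   still outside D. Unboundedness of X only serves to provide a nonzero v in D. *)
theory Submission
  imports Defs
begin

lemma cinner_add_right: "cinner x (y + z) = cinner x y + cinner x z"
  for x y z :: "'a::complex_inner"
  by (subst (1 2 3) cinner_commute) (simp add: cinner_add_left)

lemma cinner_scaleC_right: "cinner x (c *\<^sub>C y) = cnj c * cinner x y"
  for x y :: "'a::complex_inner"
  by (subst (1 2) cinner_commute) (simp add: cinner_scaleC_left)

text \<open>The Householder reflection: it negates \<open>u\<close> and fixes the orthogonal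
  complement of \<open>u\<close>. Dividing by \<open>cinner u u\<close> spares normalising
  \<open>u\<close>. Having \<open>x\<close> in the first slot of \<open>cinner\<close> makes the map
  complex linear rather than antilinear.\<close>

definition creflection :: "'a::complex_inner \<Rightarrow> 'a \<Rightarrow> 'a"
  where "creflection u x = x + (- (2 * cinner x u / cinner u u)) *\<^sub>C u"

lemma linear_creflection: "Vector_Spaces.linear scaleC scaleC (creflection u)"
proof (unfold_locales, goal_cases)
  case (1 x y)
  have "- (2 * cinner (x + y) u / cinner u u)
      = - (2 * cinner x u / cinner u u) + - (2 * cinner y u / cinner u u)"
    by (simp add: cinner_add_left add_divide_distrib distrib_left)
  then show ?case
    unfolding creflection_def by (simp only: scaleC_add_left add_ac)
next
  case (2 c x)
  have "- (2 * cinner (c *\<^sub>C x) u / cinner u u) = c * - (2 * cinner x u / cinner u u)"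
    by (simp add: cinner_scaleC_left)
  then show ?case
    unfolding creflection_def by (simp only: scaleC_add_right scaleC_scaleC)
qed

lemma cinner_creflection:
  assumes "u \<noteq> 0"
  shows "cinner (creflection u x) (creflection u y) = cinner x y"
proof -
  define a where "a = - (2 * cinner x u / cinner u u)"
  define b where "b = - (2 * cinner y u / cinner u u)"
  have nz: "cinner u u \<noteq> 0"
    using assms by (simp add: cinner_eq_zero_iff)
  have a: "a * cinner u u = - 2 * cinner x u"
    using nz by (simp add: a_def)
  have "b * cinner u u = - 2 * cinner y u"
    using nz by (simp add: b_def)
  then have "cnj (b * cinner u u) = cnj (- 2 * cinner y u)"
    by (rule arg_cong)
  \<comment> \<open>Conjugation swaps the slots of \<open>cinner\<close>, so
    \<open>cinner u u\<close> is its own conjugate.\<close>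
  then have b: "cnj b * cinner u u = - 2 * cinner u y"
    by (simp flip: cinner_commute[of u u] cinner_commute[of u y])
  \<comment> \<open>The bracket collects the cross terms of the expanded inner product. Doubled, the
    first two summands each become \<open>- a * cnj b * cinner u u\<close> by \<open>b\<close> and
    \<open>a\<close>, which cancels twice the third.\<close>
  have "2 * (a * cinner u y + cnj b * (cinner x u + a * cinner u u)) = 0"
    using a b by algebra
  then have "a * cinner u y + cnj b * (cinner x u + a * cinner u u) = 0"
    by (simp only: mult_eq_0_iff) simp
  then show ?thesis
    unfolding creflection_def cinner_add_left cinner_add_right cinner_scaleC_left
      cinner_scaleC_right a_def[symmetric] b_def[symmetric]
    by (simp add: algebra_simps)
qed

text \<open>Reflecting flips the sign of the inner product with \<open>u\<close>, so the second
  correction undoes the first. Being an involution gives surjectivity, which in infinite dimension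
  does not follow from preserving inner products.\<close>

lemma creflection_creflection:
  assumes "u \<noteq> 0"
  shows "creflection u (creflection u x) = x"
proof -
  define a where "a = - (2 * cinner x u / cinner u u)"
  have nz: "cinner u u \<noteq> 0"
    using assms by (simp add: cinner_eq_zero_iff)
  then have "a * cinner u u = - 2 * cinner x u"
    by (simp add: a_def)
  then have "2 * cinner (x + a *\<^sub>C u) u = a * cinner u u"
    unfolding cinner_add_left cinner_scaleC_left by algebra
  then have coeff: "2 * cinner (x + a *\<^sub>C u) u / cinner u u = a"
    using nz by simp
  have "creflection u x = x + a *\<^sub>C u"
    by (simp only: creflection_def a_def)
  moreover have "creflection u (x + a *\<^sub>C u) = x + a *\<^sub>C u + (- a) *\<^sub>C u"
    unfolding creflection_def coeff by (rule refl)
  ultimately show ?thesis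
    by simp
qed

lemma unitary_creflection:
  assumes "u \<noteq> 0"
  shows "unitary (creflection u)"
  unfolding unitary_def
proof (intro conjI allI)
  show "surj (creflection u)"
    using creflection_creflection[OF assms] by (rule surjI)
qed (simp_all add: linear_creflection cinner_creflection assms)

lemma creflection_notin_subspace:
  assumes D: "complex_vector.subspace D" and "v \<in> D" and "u \<notin> D" and "cinner v u \<noteq> 0"
  shows "creflection u v \<notin> D"
proof
  define c where "c = - (2 * cinner v u / cinner u u)"
  have "u \<noteq> 0"
    using assms complex_vector.subspace_0 by blast
  \<comment> \<open>Here \<open>u \<noteq> 0\<close> matters: with divisor 0 the quotient would be
    0.\<close>
  then have "c \<noteq> 0"
    using \<open>cinner v u \<noteq> 0\<close> by (simp add: c_def cinner_eq_zero_iff)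
  assume "creflection u v \<in> D"
  then have "c *\<^sub>C u \<in> D"
    using complex_vector.subspace_diff[OF D _ \<open>v \<in> D\<close>]
    by (force simp: creflection_def simp flip: c_def)
  then have "(1 / c) *\<^sub>C c *\<^sub>C u \<in> D"
    using complex_vector.subspace_scale[OF D] by blast
  with \<open>c \<noteq> 0\<close> \<open>u \<notin> D\<close> show False
    by (simp add: scaleC_scaleC)
qed

text \<open>The bound fails already for \<open>C = 0\<close>, so \<open>X v\<close> is nonzero for
  some \<open>v\<close> in \<open>D\<close>, whereas homogeneity with scalar 0 forces
  \<open>X 0 = 0\<close>.\<close>

lemma unbounded_on_imp_nonzero:
  assumes "clinear_on D X" and "unbounded_on D X"
  obtains v where "v \<in> D" and "v \<noteq> 0"
proof -
  obtain v where v: "v \<in> D" "norm (X v) > 0"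
    using \<open>unbounded_on D X\<close> unfolding unbounded_on_def by (metis mult_zero_left not_less)
  have "v \<noteq> 0"
  proof
    assume "v = 0"
    with v have "X (0 *\<^sub>C v) = 0 *\<^sub>C X v"
      using \<open>clinear_on D X\<close> unfolding clinear_on_def by blast
    with v \<open>v = 0\<close> show False by simp
  qed
  with v that show thesis by blast
qed

theorem proposition8:
  fixes D :: "'h::chilbert_space set"
    and X :: "'h \<Rightarrow> 'y::chilbert_space"
  assumes "complex_vector.subspace D"
    and "D \<noteq> UNIV"
    and "clinear_on D X"
    and "unbounded_on D X"
  shows "\<exists>U :: 'h \<Rightarrow> 'h. unitary U \<and> \<not> U ` D \<subseteq> D"
proof -
  obtain v where v: "v \<in> D" "v \<noteq> 0"
    using assms(3,4) by (rule unbounded_on_imp_nonzero)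
  obtain w where w: "w \<notin> D"
    using assms(2) by blast
  obtain u where u: "u \<notin> D" "cinner v u \<noteq> 0"
  proof (cases "cinner v w = 0")
    case True
    \<comment> \<open>By orthogonality this inner product is just \<open>cinner v v\<close>.\<close>
    then have "cinner v (w + v) \<noteq> 0"
      using v by (simp add: cinner_add_right cinner_eq_zero_iff)
    \<comment> \<open>Otherwise subtracting \<open>v\<close> would put \<open>w\<close> in
      \<open>D\<close>.\<close>
    moreover have "w + v \<notin> D"
      using complex_vector.subspace_diff[OF assms(1) _ v(1), of "w + v"] w by auto
    ultimately show thesis
      using that by blast
  next
    case False
    with w that show thesis by blast
  qed
  have "u \<noteq> 0"
    using u(1) assms(1) complex_vector.subspace_0 by blast
  then have "unitary (creflection u)"
    by (rule unitary_creflection)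
  moreover have "creflection u v \<notin> D"
    using assms(1) v(1) u by (rule creflection_notin_subspace)
  ultimately show ?thesis
    using v(1) by blast
qed

end
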